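(* Let $p$ and $q$ be distinct primes, let $G$ be a cyclic group of order $p^2q^2$ with identity $e_G$, let $S_1=\{x\in G: |x|=p \text{ or } |x|=q\}$, $S_2=\{x\in G: |x|=p^2 \text{ or } |x|=q^2\}$, $S_3=\{e_G\}$, and let $\Gamma=\mathrm{BiCay}(G;S_1,S_2,S_3)$. Then $\Gamma$ has $2p^2q^2$ vertices, is biregular of degrees $p(p-1)+q(q-1)+1$ and $p+q-1$, and has $\dfrac{p^2q^2(p^2+q^2)}{2}$ edges.
   Context: $|x|$ denotes the order of the element $x$. For a group $G$ and nonempty subsets $S_1,S_2,S_3\subseteq G$ with $S_1,S_2,S_3$ inverse-closed and $e_G\notin S_1\cup S_2$, the Bi-Cayley graph $\mathrm{BiCay}(G;S_1,S_2,S_3)$ is the simple graph with vertex set $\{0,1\}\times G$ in which two distinct vertices $(i,x),(j,y)$ are adjacent iff: $xy^{-1}\in S_1$ when $i=j=0$; $xy^{-1}\in S_2$ when $i=j=1$; $xy^{-1}\in S_3$ when $i\ne j$. A graph is biregular of degrees $d$ and $d'$ if every vertex has degree $d$ or $d'$ and both degrees occur. *)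

theory Defs
  imports "HOL-Algebra.Algebra" "HOL-Computational_Algebra.Primes" Complex_Main
begin

hide_const (open) Divisibility.prime

text \<open>The edges are two-element sets of vertices, so loops and multiple edges are excluded.\<close>

record 'v sgraph =
  verts :: "'v set"
  edges :: "'v set set"

definition simple_graph :: "'v sgraph \<Rightarrow> bool" where
  "simple_graph \<Gamma> \<longleftrightarrow> (\<forall>e\<in>edges \<Gamma>. e \<subseteq> verts \<Gamma> \<and> card e = 2)"

definition vertex_degree :: "'v sgraph \<Rightarrow> 'v \<Rightarrow> nat" where
  "vertex_degree \<Gamma> v = card {e \<in> edges \<Gamma>. v \<in> e}"

definition biregular :: "'v sgraph \<Rightarrow> nat \<Rightarrow> nat \<Rightarrow> bool" where
  "biregular \<Gamma> d d' \<longleftrightarrow>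
     (\<forall>v\<in>verts \<Gamma>. vertex_degree \<Gamma> v = d \<or> vertex_degree \<Gamma> v = d') \<and>
     (\<exists>v\<in>verts \<Gamma>. vertex_degree \<Gamma> v = d) \<and> (\<exists>v\<in>verts \<Gamma>. vertex_degree \<Gamma> v = d')"

fun bicay_adj ::
  "('a, 'b) monoid_scheme \<Rightarrow> 'a set \<Rightarrow> 'a set \<Rightarrow> 'a set \<Rightarrow> nat \<times> 'a \<Rightarrow> nat \<times> 'a \<Rightarrow> bool"
where
  "bicay_adj G S1 S2 S3 (i, x) (j, y) \<longleftrightarrow>
     x \<otimes>\<^bsub>G\<^esub> inv\<^bsub>G\<^esub> y \<in> (if i \<noteq> j then S3 else if i = 0 then S1 else S2)"

definition BiCay ::
  "('a, 'b) monoid_scheme \<Rightarrow> 'a set \<Rightarrow> 'a set \<Rightarrow> 'a set \<Rightarrow> (nat \<times> 'a) sgraph"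
where
  "BiCay G S1 S2 S3 =
     \<lparr>verts = {0, 1} \<times> carrier G,
      edges = {{u, v} | u v. u \<in> {0, 1} \<times> carrier G \<and> v \<in> {0, 1} \<times> carrier G \<and>
                             u \<noteq> v \<and> bicay_adj G S1 S2 S3 u v}\<rparr>"

text \<open>
  The conditions under which a Bi-Cayley graph is defined. They make the adjacency relation
  symmetric, so that the unordered edges above represent it exactly
  (lemma \<open>BiCay_edge_iff\<close>).
\<close>

definition connection_sets ::
  "('a, 'b) monoid_scheme \<Rightarrow> 'a set \<Rightarrow> 'a set \<Rightarrow> 'a set \<Rightarrow> bool"
where
  "connection_sets G S1 S2 S3 \<longleftrightarrow>
     (\<forall>S\<in>{S1, S2, S3}. S \<noteq> {} \<and> S \<subseteq> carrier G \<and> (\<forall>x\<in>S. inv\<^bsub>G\<^esub> x \<in> S)) \<and>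
     \<one>\<^bsub>G\<^esub> \<notin> S1 \<union> S2"

lemma simple_graph_BiCay: "simple_graph (BiCay G S1 S2 S3)"
proof -
  have "e \<subseteq> verts (BiCay G S1 S2 S3) \<and> card e = 2" if e: "e \<in> edges (BiCay G S1 S2 S3)" for e
  proof -
    obtain u v where "e = {u, v}" "u \<in> {0, 1} \<times> carrier G" "v \<in> {0, 1} \<times> carrier G" "u \<noteq> v"
      using e unfolding BiCay_def sgraph.simps mem_Collect_eq by blast
    then show ?thesis unfolding BiCay_def sgraph.simps by simp
  qed
  then show ?thesis unfolding simple_graph_def by blast
qed

lemma BiCay_edge_iff:
  fixes G (structure)
  assumes G: "group G" and S: "connection_sets G S1 S2 S3"
    and u: "u \<in> verts (BiCay G S1 S2 S3)" and v: "v \<in> verts (BiCay G S1 S2 S3)"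
  shows "{u, v} \<in> edges (BiCay G S1 S2 S3) \<longleftrightarrow> u \<noteq> v \<and> bicay_adj G S1 S2 S3 u v"
proof -
  interpret group G by (rule G)
  have sym: "bicay_adj G S1 S2 S3 b a"
    if "bicay_adj G S1 S2 S3 a b" "a \<in> {0, 1} \<times> carrier G" "b \<in> {0, 1} \<times> carrier G" for a b
  proof -
    obtain i x j y where ab: "a = (i, x)" "b = (j, y)" by (cases a, cases b)
    then have inv: "inv (x \<otimes> inv y) = y \<otimes> inv x" using that by (auto simp: inv_mult_group)
    have closed: "\<forall>s\<in>S1. inv s \<in> S1" "\<forall>s\<in>S2. inv s \<in> S2" "\<forall>s\<in>S3. inv s \<in> S3"
      using S by (simp_all add: connection_sets_def)
    have "x \<otimes> inv y \<in> (if i \<noteq> j then S3 else if i = 0 then S1 else S2)"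
      using that(1) ab by simp
    then have "inv (x \<otimes> inv y) \<in> (if j \<noteq> i then S3 else if j = 0 then S1 else S2)"
      using closed by (simp split: if_split_asm)
    then show ?thesis using ab inv by simp
  qed
  let ?V = "{0, 1} \<times> carrier G"
  have uv: "u \<in> ?V" "v \<in> ?V" using u v by (simp_all add: BiCay_def)
  have "{u, v} \<in> edges (BiCay G S1 S2 S3) \<longleftrightarrow>
      (\<exists>a b. {u, v} = {a, b} \<and> a \<in> ?V \<and> b \<in> ?V \<and> a \<noteq> b \<and> bicay_adj G S1 S2 S3 a b)"
    unfolding BiCay_def sgraph.simps mem_Collect_eq ..
  also have "\<dots> \<longleftrightarrow> u \<noteq> v \<and> bicay_adj G S1 S2 S3 u v"
    using uv sym by (metis doubleton_eq_iff)
  finally show ?thesis .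
qed

text \<open>In particular, \<open>connection_sets\<close> holds for the sets of elements of the following orders.\<close>

lemma connection_sets_cyclic:
  fixes G (structure) and p q :: nat
  assumes G: "group G" and cyc: "cyclic_group G"
    and pq: "prime p" "prime q" and ord: "order G = p ^ 2 * q ^ 2"
  shows "connection_sets G
           {x \<in> carrier G. group.ord G x = p \<or> group.ord G x = q}
           {x \<in> carrier G. group.ord G x = p ^ 2 \<or> group.ord G x = q ^ 2}
           {\<one>\<^bsub>G\<^esub>}"
proof -
  interpret group G by (rule G)
  have pos: "p > 1" "q > 1" using pq prime_gt_1_nat by auto
  obtain g where g: "g \<in> carrier G" "subgroup_generated G {g} = G"
    using cyc by (auto simp: cyclic_group_def)
  have "carrier G = generate G {g}"
    using g by (metis carrier_subgroup_generated Int_insert_right_if1 Int_empty_right)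
  then have og: "ord g = p ^ 2 * q ^ 2"
    using g ord generate_pow_card[of g] by (simp add: order_def)
  have ex: "\<exists>x\<in>carrier G. ord x = d" if dvd: "d dvd p ^ 2 * q ^ 2" for d
  proof -
    obtain k where k: "p ^ 2 * q ^ 2 = d * k" using dvd by (rule dvdE)
    then have "k \<noteq> 0" using pos by (intro notI) simp
    then have "ord (g [^] k) = d"
      using ord_pow[of g k] g(1) og k \<open>k \<noteq> 0\<close> by simp
    then show ?thesis using g by blast
  qed
  have ex_p: "\<exists>x\<in>carrier G. ord x = p" "\<exists>x\<in>carrier G. ord x = p ^ 2"
    by (rule ex; simp add: power2_eq_square)+
  have "p \<noteq> 1" "q \<noteq> 1" "p ^ 2 \<noteq> 1" "q ^ 2 \<noteq> 1"
    using pos by (simp_all add: power2_eq_square)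
  then have "ord \<one> \<noteq> p" "ord \<one> \<noteq> q" "ord \<one> \<noteq> p ^ 2" "ord \<one> \<noteq> q ^ 2"
    by (metis ord_id)+
  with ex_p show ?thesis
    unfolding connection_sets_def by auto
qed

end

theory Submission
  imports Defs "HOL-Number_Theory.Totient"
begin

text \<open>
  A cyclic group of order \<open>n\<close> has \<open>totient d\<close> elements of order \<open>d\<close> for each \<open>d dvd n\<close>, which gives
  the sizes of the connection sets. The vertex \<open>(i, x)\<close> is joined to \<open>(i, inv s \<otimes> x)\<close> for \<open>s\<close> in
  \<open>S1\<close> or \<open>S2\<close>, and to \<open>(1 - i, x)\<close>; summing the two degrees over both layers counts each edge twice.
\<close>

lemma (in group) card_ord_eq_totient:
  assumes cyc: "cyclic_group G" and n: "order G > 0" and d: "d dvd order G"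
  shows "card {x \<in> carrier G. ord x = d} = totient d"
proof -
  let ?n = "order G" and ?K = "{k \<in> {0<..order G}. gcd k (order G) = order G div d}"
  have fin: "finite (carrier G)" using n by (simp add: order_gt_0_iff_finite)
  obtain g where g: "g \<in> carrier G" "subgroup_generated G {g} = G"
    using cyc by (auto simp: cyclic_group_def)
  have gen: "carrier G = generate G {g}"
    using g by (metis carrier_subgroup_generated Int_insert_right_if1 Int_empty_right)
  then have og: "ord g = ?n"
    using g generate_pow_card[of g] by (simp add: order_def)
  \<comment> \<open>Exponents run over \<open>{0<..?n}\<close>, a full period of \<open>g\<close>
    without zero: the order formula for a power treats exponent 0 separately, and the gcd count
    below uses the same range.\<close>
  have inj: "inj_on (\<lambda>k. g [^] k) {0<..?n}"
    using ord_inj'[OF g(1)] og by (simp add: atLeastSucAtMost_greaterThanAtMost)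
  then have img: "(\<lambda>k. g [^] k) ` {0<..?n} = carrier G"
    using fin g(1) by (intro card_subset_eq) (auto simp: card_image order_def)
  have ordg: "ord (g [^] k) = d \<longleftrightarrow> gcd k ?n = ?n div d" if k: "k \<in> {0<..?n}" for k
  proof -
    have "ord (g [^] k) = ?n div gcd ?n k"
      using ord_pow_gen[OF g(1), of k] k og by simp
    \<comment> \<open>Both \<open>d\<close> and the gcd divide \<open>?n\<close>, so each side says
      that their product is \<open>?n\<close>.\<close>
    moreover have "?n div gcd k ?n = d \<longleftrightarrow> gcd k ?n = ?n div d"
    proof -
      have "gcd k ?n dvd ?n" by simp
      with d obtain a b where "?n = d * a" "?n = gcd k ?n * b" by (metis dvdE)
      with n show ?thesis
        by (metis nonzero_mult_div_cancel_left mult_zero_left mult_zero_right mult.commute less_irrefl)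
    qed
    ultimately show ?thesis by (simp add: gcd.commute)
  qed
  have "{x \<in> carrier G. ord x = d} = (\<lambda>k. g [^] k) ` ?K"
    unfolding img[symmetric] using ordg by blast
  then have "card {x \<in> carrier G. ord x = d} = card ?K"
    using inj by (metis (no_types, lifting) card_image inj_on_subset mem_Collect_eq subsetI)
  \<comment> \<open>Dividing \<open>k\<close> and \<open>?n\<close> by their gcd
    \<open>?n div d\<close> leaves the numbers up to \<open>d\<close> that are coprime to
    \<open>d\<close>.\<close>
  also have "\<dots> = totient (?n div (?n div d))"
    by (rule card_gcd_eq_totient) (use n d in auto)
  also have "?n div (?n div d) = d" using n d by auto
  finally show ?thesis .
qed

text \<open>Double counting of incidences: an edge is a two-element set of vertices, so it
  contributes to exactly two degrees.\<close>

lemma handshake: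
  assumes "simple_graph \<Gamma>" and fin: "finite (verts \<Gamma>)"
  shows "(\<Sum>v\<in>verts \<Gamma>. vertex_degree \<Gamma> v) = 2 * card (edges \<Gamma>)"
proof -
  have e: "e \<subseteq> verts \<Gamma>" "card e = 2" if "e \<in> edges \<Gamma>" for e
    using assms(1) that by (auto simp: simple_graph_def)
  have "edges \<Gamma> \<subseteq> Pow (verts \<Gamma>)" using e(1) by blast
  then have "finite (edges \<Gamma>)" using fin by (simp add: finite_subset)
  moreover have "card {v \<in> verts \<Gamma>. v \<in> e} = 2" if "e \<in> edges \<Gamma>" for e
  proof -
    have "{v \<in> verts \<Gamma>. v \<in> e} = e" using e(1)[OF that] by blast
    then show ?thesis using e(2)[OF that] by simp
  qed
  ultimately show ?thesis
    unfolding vertex_degree_def using fin by (intro sum_multicount) auto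
qed

text \<open>An incident edge is determined by its other endpoint, and solving the adjacency
  condition for that endpoint parametrises the neighbours injectively by connection set elements.
  Neighbours in the two layers differ in the first coordinate, so the counts add even if
  \<open>S3\<close> meets \<open>S1\<close> or \<open>S2\<close>.\<close>

lemma vertex_degree_BiCay:
  fixes G (structure)
  assumes G: "group G" and fin: "finite (carrier G)" and S: "connection_sets G S1 S2 S3"
    and x: "x \<in> carrier G" and i: "i \<in> {0, 1}"
  shows "vertex_degree (BiCay G S1 S2 S3) (i, x) = card (if i = 0 then S1 else S2) + card S3"
proof -
  interpret group G by (rule G)
  let ?\<Gamma> = "BiCay G S1 S2 S3" and ?T = "if i = 0 then S1 else S2"
  \<comment> \<open>The equation \<open>x \<otimes> inv y = s\<close> has the unique solution
    \<open>y = inv s \<otimes> x\<close>; since \<open>i\<close> is 0 or 1, the other layer is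
    \<open>1 - i\<close>.\<close>
  let ?nb = "\<lambda>j s. (j, inv s \<otimes> x)"
  let ?N = "?nb i ` ?T \<union> ?nb (1 - i) ` S3"
  have sub: "?T \<subseteq> carrier G" "S3 \<subseteq> carrier G" "\<one> \<notin> ?T"
    using S by (auto simp: connection_sets_def)
  have inj: "inj_on (?nb j) (carrier G)" for j :: nat
    using x by (auto intro!: inj_onI)
  have verts: "verts ?\<Gamma> = {0, 1} \<times> carrier G" by (simp add: BiCay_def)
  \<comment> \<open>The condition \<open>(i, x) \<noteq> w\<close> removes nothing from
    \<open>?N\<close>: a loop would put the identity into \<open>?T\<close>.\<close>
  have nb: "w \<in> verts ?\<Gamma> \<and> (i, x) \<noteq> w \<and> bicay_adj G S1 S2 S3 (i, x) w \<longleftrightarrow> w \<in> ?N" for w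
  proof -
    obtain j y where w: "w = (j, y)" by (cases w)
    have solve: "y = inv s \<otimes> x \<longleftrightarrow> y \<in> carrier G \<and> s = x \<otimes> inv y" if "s \<in> carrier G" for s
      using x that by (metis inv_closed inv_solve_left inv_solve_right m_closed)
    have mem: "w \<in> ?nb k ` T \<longleftrightarrow> j = k \<and> y \<in> carrier G \<and> x \<otimes> inv y \<in> T"
      if "T \<subseteq> carrier G" for k T
    proof -
      have "w \<in> ?nb k ` T \<longleftrightarrow> j = k \<and> (\<exists>s\<in>T. y = inv s \<otimes> x)" using w by auto
      also have "(\<exists>s\<in>T. y = inv s \<otimes> x) \<longleftrightarrow> (\<exists>s\<in>T. y \<in> carrier G \<and> s = x \<otimes> inv y)"
        by (intro bex_cong refl solve subsetD[OF that])
      finally show ?thesis by simp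
    qed
    show ?thesis
      using i sub x unfolding Un_iff mem[OF sub(1)] mem[OF sub(2)] by (auto simp: w verts)
  qed
  have "{e \<in> edges ?\<Gamma>. (i, x) \<in> e} = (\<lambda>w. {(i, x), w}) ` ?N"
  proof (intro equalityI subsetI)
    fix e assume "e \<in> {e \<in> edges ?\<Gamma>. (i, x) \<in> e}"
    then have e: "e \<in> edges ?\<Gamma>" "(i, x) \<in> e" by auto
    with simple_graph_BiCay[of G S1 S2 S3] have "card e = 2" "e \<subseteq> verts ?\<Gamma>"
      by (auto simp: simple_graph_def)
    with e obtain w where w: "e = {(i, x), w}" "w \<in> verts ?\<Gamma>"
      by (auto simp: card_2_iff)
    then show "e \<in> (\<lambda>w. {(i, x), w}) ` ?N"
      using e BiCay_edge_iff[OF G S, of "(i, x)" w] nb[of w] x i verts by auto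
  next
    fix e assume "e \<in> (\<lambda>w. {(i, x), w}) ` ?N"
    then obtain w where w: "e = {(i, x), w}" "w \<in> ?N" by auto
    then show "e \<in> {e \<in> edges ?\<Gamma>. (i, x) \<in> e}"
      using BiCay_edge_iff[OF G S, of "(i, x)" w] nb[of w] x i verts by auto
  qed
  moreover have "inj_on (\<lambda>w. {(i, x), w}) ?N"
    by (rule inj_onI) (metis doubleton_eq_iff)
  ultimately have "vertex_degree ?\<Gamma> (i, x) = card ?N"
    by (simp add: vertex_degree_def card_image)
  also have "\<dots> = card (?nb i ` ?T) + card (?nb (1 - i) ` S3)"
  proof (rule card_Un_disjoint)
    show "finite (?nb i ` ?T)" "finite (?nb (1 - i) ` S3)"
      using finite_subset[OF sub(1) fin] finite_subset[OF sub(2) fin] by simp_all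
  qed (use i in auto)
  also have "\<dots> = card ?T + card S3"
    by (simp only: card_image[OF inj_on_subset[OF inj sub(1)]]
        card_image[OF inj_on_subset[OF inj sub(2)]])
  finally show ?thesis .
qed

theorem proposition2p7:
  fixes G :: "('a, 'b) monoid_scheme" and p q :: nat
    and S1 S2 S3 :: "'a set" and \<Gamma> :: "(nat \<times> 'a) sgraph"
  assumes "prime p" and "prime q" and "p \<noteq> q"
    and "group G" and "cyclic_group G" and "order G = p ^ 2 * q ^ 2"
    and "S1 = {x \<in> carrier G. group.ord G x = p \<or> group.ord G x = q}"
    and "S2 = {x \<in> carrier G. group.ord G x = p ^ 2 \<or> group.ord G x = q ^ 2}"
    and "S3 = {\<one>\<^bsub>G\<^esub>}"
    and "\<Gamma> = BiCay G S1 S2 S3"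
  shows "card (verts \<Gamma>) = 2 * p ^ 2 * q ^ 2 \<and>
         biregular \<Gamma> (p * (p - 1) + q * (q - 1) + 1) (p + q - 1) \<and>
         real (card (edges \<Gamma>)) = real (p ^ 2 * q ^ 2 * (p ^ 2 + q ^ 2)) / 2"
proof -
  interpret group G by fact
  have pos: "p > 1" "q > 1" using assms(1,2) prime_gt_1_nat by auto
  then have n: "order G > 0" using assms(6) by simp
  then have fin: "finite (carrier G)" by (simp add: order_gt_0_iff_finite)
  have S: "connection_sets G S1 S2 S3"
    using connection_sets_cyclic[OF assms(4,5,1,2,6)] assms(7-9) by simp
  have card_ords: "card {x \<in> carrier G. ord x = a \<or> ord x = b} = totient a + totient b"
    if "a dvd order G" "b dvd order G" "a \<noteq> b" for a b
  proof -
    have "{x \<in> carrier G. ord x = a \<or> ord x = b} =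
        {x \<in> carrier G. ord x = a} \<union> {x \<in> carrier G. ord x = b}" by auto
    then show ?thesis
      using that fin n assms(5)
      by (simp add: card_Un_disjoint disjoint_iff card_ord_eq_totient)
  qed
  have "card S1 = (p - 1) + (q - 1)"
    unfolding assms(7) using assms(1-3,6)
    by (subst card_ords) (simp_all add: totient_prime power2_eq_square)
  then have c1: "card S1 + card S3 = p + q - 1" using pos assms(9) by simp
  have "card S2 = p * (p - 1) + q * (q - 1)"
    unfolding assms(8) using assms(1-3,6)
    by (subst card_ords) (simp_all add: totient_prime_power)
  then have c2: "card S2 + card S3 = p * (p - 1) + q * (q - 1) + 1" using assms(9) by simp
  have verts: "verts \<Gamma> = {0, 1} \<times> carrier G" by (simp add: assms(10) BiCay_def)
  have deg: "vertex_degree \<Gamma> (0, x) = p + q - 1"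
      "vertex_degree \<Gamma> (1, x) = p * (p - 1) + q * (q - 1) + 1" if "x \<in> carrier G" for x
    unfolding assms(10) using vertex_degree_BiCay[OF assms(4) fin S that, of 0]
      vertex_degree_BiCay[OF assms(4) fin S that, of 1] c1 c2 by simp_all
  \<comment> \<open>The identity element, taken once in each layer, witnesses that both degrees
    occur.\<close>
  have "biregular \<Gamma> (p * (p - 1) + q * (q - 1) + 1) (p + q - 1)"
    unfolding biregular_def verts using deg one_closed by auto
  moreover have "card (verts \<Gamma>) = 2 * p ^ 2 * q ^ 2"
    using assms(6) by (simp add: verts order_def card_cartesian_product)
  \<comment> \<open>The doubled count stays in the naturals; the division by 2 happens only in the
    final passage to the reals.\<close>
  moreover have "2 * card (edges \<Gamma>) = p ^ 2 * q ^ 2 * (p ^ 2 + q ^ 2)"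
  proof -
    have "2 * card (edges \<Gamma>) = (\<Sum>v\<in>verts \<Gamma>. vertex_degree \<Gamma> v)"
      using handshake[of \<Gamma>] fin verts simple_graph_BiCay[of G S1 S2 S3] assms(10) by simp
    also have "\<dots> = (\<Sum>i\<in>{0, 1}. \<Sum>x\<in>carrier G. vertex_degree \<Gamma> (i, x))"
      by (simp only: verts sum.cartesian_product split_def prod.collapse)
    also have "\<dots> = order G * (p + q - 1 + (p * (p - 1) + q * (q - 1) + 1))"
      using deg by (simp add: order_def algebra_simps)
    \<comment> \<open>The \<open>- 1\<close> and \<open>+ 1\<close> cancel and
      \<open>p + p * (p - 1) = p ^ 2\<close>, likewise for \<open>q\<close>. Writing
      \<open>p\<close> and \<open>q\<close> as successors removes the truncated subtraction.\<close>
    also have "p + q - 1 + (p * (p - 1) + q * (q - 1) + 1) = p ^ 2 + q ^ 2"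
      using pos by (auto simp: power2_eq_square algebra_simps dest!: less_imp_Suc_add)
    finally show ?thesis using assms(6) by simp
  qed
  ultimately show ?thesis
    by (simp add: field_simps flip: of_nat_mult)
qed

end
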